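(* Let $p$ be a prime, $\mathbb{C}_p$ the completion of an algebraic closure of $\mathbb{Q}_p$, $k\in\mathbb{Z}$, and $\lambda\in\mathbb{C}_p$ with $\lambda\neq0$. Define the formal power series $$G(t)=\frac{\mathrm{Li}_{k}\left(1-(1+\lambda t)^{-\frac{1}{\lambda}}\right)}{(1+\lambda t)^{\frac{1}{\lambda}}-1},\qquad F(t)=\frac{(e^{t}-1)\,\mathrm{Li}_{k}\left(1-(1+\lambda t)^{-\frac{1}{\lambda}}\right)}{t\left((1+\lambda t)^{\frac{1}{\lambda}}-1\right)}.$$ Then for every polynomial $p(x)\in\mathbb{C}_p[x]$, $$F(t)\int_{\mathbb{Z}_p}p(x+y)\,d\mu_0(y)=F(t)\int_{\mathbb{Z}_p}e^{yt}p(x)\,d\mu_0(y)=G(t)p(x).$$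
   Context: $\mathrm{Li}_k(x)=\sum_{n\ge1}x^n/n^k$ is the polylogarithm. Power series are formal in $t$ over $\mathbb{C}_p$; $(1+\lambda t)^{1/\lambda}$ means $\exp\left(\frac1\lambda\log(1+\lambda t)\right)$. A power series $f(t)=\sum_k a_k\frac{t^k}{k!}$ acts on polynomials in $x$ as a linear operator via $t^kp(x)=\frac{d^k}{dx^k}p(x)$. The $p$-adic invariant integral is $\int_{\mathbb{Z}_p}f(y)\,d\mu_0(y)=\lim_{N\to\infty}p^{-N}\sum_{y=0}^{p^N-1}f(y)$. $\int_{\mathbb{Z}_p}p(x+y)\,d\mu_0(y)$ is the polynomial in $x$ obtained by integrating in $y$; $\int_{\mathbb{Z}_p}e^{yt}p(x)\,d\mu_0(y)$ denotes the operator $\sum_{n\ge0}\left(\int_{\mathbb{Z}_p}y^nd\mu_0(y)\right)\frac{t^n}{n!}$ applied to $p(x)$. In each expression the operator $F(t)$ is applied to the resulting polynomial in $x$. *)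

theory Defs
  imports
    "HOL-Analysis.Analysis"
    "HOL-Computational_Algebra.Computational_Algebra"
begin

text \<open>
  The field of \<open>p\<close>-adic complex numbers is only determined up to isometric isomorphism. It is
  rendered as a field type with a metric, subject to a predicate saying that the type is a
  completion of an algebraic closure of \<open>\<rat>\<^sub>p\<close>. The absolute value of \<open>x\<close> is \<open>dist x 0\<close>.
\<close>

definition padic_abs :: "nat \<Rightarrow> rat \<Rightarrow> real" where
  "padic_abs p r =
     (if r = 0 then 0
      else real p powi (int (multiplicity (int p) (snd (quotient_of r)))
                      - int (multiplicity (int p) (fst (quotient_of r)))))"

definition subfield_set :: "'a::field set \<Rightarrow> bool" where
  "subfield_set K \<longleftrightarrow>
     0 \<in> K \<and> 1 \<in> K \<and>
     (\<forall>x\<in>K. \<forall>y\<in>K. x - y \<in> K \<and> x * y \<in> K) \<and>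
     (\<forall>x\<in>K. inverse x \<in> K)"

definition poly_over :: "'a::field set \<Rightarrow> 'a poly \<Rightarrow> bool" where
  "poly_over K f \<longleftrightarrow> (\<forall>i. coeff f i \<in> K)"

definition is_algebraic_closure :: "'a::field set \<Rightarrow> 'a set \<Rightarrow> bool" where
  "is_algebraic_closure K A \<longleftrightarrow>
     subfield_set K \<and> subfield_set A \<and> K \<subseteq> A \<and>
     (\<forall>x\<in>A. \<exists>f. f \<noteq> 0 \<and> poly_over K f \<and> poly f x = 0) \<and>
     (\<forall>f. poly_over A f \<and> degree f > 0 \<longrightarrow> (\<exists>x\<in>A. poly f x = 0))"

text \<open>
  Inside a complete field whose absolute value extends the \<open>p\<close>-adic one on \<open>\<rat>\<close>, the topological
  closure of \<open>\<rat>\<close> is a completion of \<open>\<rat>\<close>, that is, \<open>\<rat>\<^sub>p\<close>.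
\<close>

definition padic_complex_field :: "nat \<Rightarrow> 'a::{field_char_0, metric_space} itself \<Rightarrow> bool" where
  "padic_complex_field p _ \<longleftrightarrow>
     (\<forall>x y z :: 'a. dist (x + z) (y + z) = dist x y) \<and>
     (\<forall>x y :: 'a. dist (x * y) 0 = dist x 0 * dist y 0) \<and>
     (\<forall>r. dist (of_rat r :: 'a) 0 = padic_abs p r) \<and>
     complete (UNIV :: 'a set) \<and>
     (\<exists>A :: 'a set. is_algebraic_closure (closure \<rat>) A \<and> closure A = UNIV)"

text \<open>
  The integrand is a function on \<open>\<int>\<^sub>p\<close>, here the restriction of a function on the whole field;
  only its values at natural numbers enter.
\<close>

definition padic_integral ::
    "nat \<Rightarrow> ('a::{field_char_0, metric_space} \<Rightarrow> 'a) \<Rightarrow> 'a" where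
  "padic_integral p f = lim (\<lambda>N. inverse (of_nat p ^ N) * (\<Sum>y<p ^ N. f (of_nat y)))"

definition padic_integral_shift ::
    "nat \<Rightarrow> 'a::{field_char_0, metric_space} poly \<Rightarrow> 'a poly" where
  "padic_integral_shift p q =
     (THE r. \<forall>x. poly r x = padic_integral p (\<lambda>y. poly q (x + y)))"

definition padic_integral_exp :: "nat \<Rightarrow> 'a::{field_char_0, metric_space} fps" where
  "padic_integral_exp p = Abs_fps (\<lambda>n. padic_integral p (\<lambda>y. y ^ n) / fact n)"

text \<open>
  For \<open>f = (\<Sum>k. a\<^sub>k t^k / k!)\<close> the coefficient \<open>fps_nth f k\<close> is \<open>a\<^sub>k / k!\<close>, and derivatives of order
  above the degree vanish.
\<close>

definition umbral_op :: "'a::field_char_0 fps \<Rightarrow> 'a poly \<Rightarrow> 'a poly" where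
  "umbral_op f q = (\<Sum>k\<le>degree q. smult (fps_nth f k) ((pderiv ^^ k) q))"

definition fps_polylog :: "int \<Rightarrow> 'a::field_char_0 fps" where
  "fps_polylog k = Abs_fps (\<lambda>n. if n = 0 then 0 else 1 / of_nat n powi k)"

text \<open>\<open>(1 + \<lambda>t)\<^sup>a = exp (a log (1 + \<lambda>t))\<close>\<close>

definition fps_one_plus_pow :: "'a::field_char_0 \<Rightarrow> 'a \<Rightarrow> 'a fps" where
  "fps_one_plus_pow lam a =
     fps_exp 1 oo (fps_const a * (fps_ln 1 oo (fps_const lam * fps_X)))"

definition G_series :: "int \<Rightarrow> 'a::field_char_0 \<Rightarrow> 'a fps" where
  "G_series k lam =
     (fps_polylog k oo (1 - fps_one_plus_pow lam (- 1 / lam))) /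
     (fps_one_plus_pow lam (1 / lam) - 1)"

definition F_series :: "int \<Rightarrow> 'a::field_char_0 \<Rightarrow> 'a fps" where
  "F_series k lam =
     ((fps_exp 1 - 1) * (fps_polylog k oo (1 - fps_one_plus_pow lam (- 1 / lam)))) /
     (fps_X * (fps_one_plus_pow lam (1 / lam) - 1))"

end

theory Submission imports Defs begin

text \<open>
  The moments of the invariant integral are the Bernoulli numbers: dividing
  \<open>(\<Sum>y<M. e\<^bsup>yt\<^esup>) = (e\<^bsup>Mt\<^esup> - 1) / (e\<^bsup>t\<^esup> - 1)\<close> by \<open>M = p\<^sup>N\<close> and letting \<open>M\<close> tend to \<open>0\<close> in the
  \<open>p\<close>-adic metric leaves \<open>t / (e\<^bsup>t\<^esup> - 1)\<close>. By Taylor's formula, integrating \<open>q (x + y)\<close> over \<open>y\<close>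
  is therefore the action of \<open>t / (e\<^bsup>t\<^esup> - 1)\<close> on \<open>q\<close>. As composition of operators is multiplication
  of series, applying \<open>F(t)\<close> afterwards gives \<open>F(t) t / (e\<^bsup>t\<^esup> - 1) = G(t)\<close>.
\<close>

section \<open>Higher derivatives and Taylor's formula\<close>

lemma higher_pderiv_eq_0:
  fixes q :: "'a::field_char_0 poly"
  assumes "degree q < n"
  shows "(pderiv ^^ n) q = 0"
  by (rule poly_eqI) (use assms in \<open>simp add: coeff_higher_pderiv coeff_eq_0\<close>)

lemma higher_pderiv_sum: "(pderiv ^^ n) (\<Sum>i\<in>A. f i) = (\<Sum>i\<in>A. (pderiv ^^ n) (f i))"
  by (induction A rule: infinite_finite_induct) (simp_all add: higher_pderiv_add)

lemma smult_sum_right: "smult c (\<Sum>i\<in>A. f i) = (\<Sum>i\<in>A. smult c (f i))"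
  by (induction A rule: infinite_finite_induct) (simp_all add: smult_add_right)

lemma higher_pderiv_pcompose_shift:
  fixes q :: "'a::field_char_0 poly"
  shows "(pderiv ^^ n) (pcompose q [:x, 1:]) = pcompose ((pderiv ^^ n) q) [:x, 1:]"
  by (induction n) (simp_all add: pderiv_pcompose pderiv_pCons)

lemma poly_taylor:
  fixes q :: "'a::field_char_0 poly"
  shows "poly q (x + y) = (\<Sum>n\<le>degree q. poly ((pderiv ^^ n) q) x / fact n * y ^ n)"
proof -
  let ?r = "pcompose q [:x, 1:]"
  \<comment> \<open>The constant term of the \<open>n\<close>-th derivative of \<open>?r\<close> is
    computed twice: from the coefficients of \<open>?r\<close>, and by the chain rule.\<close>
  have coeff: "coeff ?r n = poly ((pderiv ^^ n) q) x / fact n" for n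
  proof -
    have "coeff ((pderiv ^^ n) ?r) 0 = fact n * coeff ?r n"
      by (simp add: coeff_higher_pderiv pochhammer_fact)
    moreover have "coeff ((pderiv ^^ n) ?r) 0 = poly ((pderiv ^^ n) q) x"
      by (simp add: higher_pderiv_pcompose_shift poly_pcompose flip: poly_0_coeff_0)
    ultimately show ?thesis
      by simp
  qed
  have "poly q (x + y) = poly ?r y"
    by (simp add: poly_pcompose)
  also have "\<dots> = (\<Sum>n\<le>degree ?r. coeff ?r n * y ^ n)"
    by (rule poly_altdef)
  finally show ?thesis
    by (simp add: coeff degree_pcompose)
qed

section \<open>Power series acting on polynomials\<close>

lemma umbral_op_altdef:
  assumes "degree q \<le> n"
  shows "umbral_op f q = (\<Sum>k\<le>n. smult (fps_nth f k) ((pderiv ^^ k) q))"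
  unfolding umbral_op_def
  by (rule sum.mono_neutral_left) (use assms in \<open>auto simp: higher_pderiv_eq_0\<close>)

lemma degree_umbral_op_le: "degree (umbral_op f q) \<le> degree q"
  unfolding umbral_op_def
proof (rule degree_sum_le)
  fix k
  have "degree ((pderiv ^^ k) q) \<le> degree q"
    by (induction k) (auto simp: degree_pderiv)
  then show "degree (smult (fps_nth f k) ((pderiv ^^ k) q)) \<le> degree q"
    using degree_smult_le order_trans by blast
qed simp

text \<open>Of the double sum over a square, only the triangle \<open>i + j \<le> n\<close>
  survives, since higher derivatives vanish. Grouping it by \<open>i + j\<close> gives the Cauchy
  product.\<close>

lemma umbral_op_mult: "umbral_op f (umbral_op g q) = umbral_op (f * g) q"
proof -
  define n where "n = degree q"
  define h where "h i j = smult (fps_nth f i * fps_nth g j) ((pderiv ^^ (i + j)) q)" for i j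
  have h_eq_0: "h i j = 0" if "n < i + j" for i j
    using that by (simp add: h_def n_def higher_pderiv_eq_0)
  have "umbral_op f (umbral_op g q) = (\<Sum>i\<le>n. smult (fps_nth f i) ((pderiv ^^ i) (umbral_op g q)))"
    by (rule umbral_op_altdef) (simp add: n_def degree_umbral_op_le)
  also have "\<dots> = (\<Sum>i\<le>n. \<Sum>j\<le>n. h i j)"
    by (simp add: umbral_op_def n_def h_def higher_pderiv_sum higher_pderiv_smult smult_sum_right funpow_add)
  also have "\<dots> = (\<Sum>(i, j)\<in>{..n} \<times> {..n}. h i j)"
    by (simp add: sum.cartesian_product)
  also have "\<dots> = (\<Sum>(i, j)\<in>{(i, j). i + j \<le> n}. h i j)"
    proof (rule sum.mono_neutral_right)
    show "\<forall>x\<in>{..n} \<times> {..n} - {(i, j). i + j \<le> n}. (case x of (i, j) \<Rightarrow> h i j) = 0"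
      using h_eq_0 by (force simp: not_le)
  qed auto
  also have "\<dots> = (\<Sum>k\<le>n. \<Sum>i\<le>k. h i (k - i))"
    by (rule sum.triangle_reindex_eq)
  also have "\<dots> = umbral_op (f * g) q"
    by (simp add: umbral_op_def n_def h_def fps_mult_nth smult_sum atLeast0AtMost)
  finally show ?thesis .
qed

section \<open>The Bernoulli series \<open>t / (e^t - 1)\<close> and sums of powers\<close>

definition fps_bernoulli :: "'a::field_char_0 fps" where
  "fps_bernoulli = inverse (fps_shift 1 (fps_exp 1 - 1))"

lemma fps_exp_minus_1_eq:
  "fps_exp (c::'a::field_char_0) - 1 = fps_X * fps_shift 1 (fps_exp c - 1)"
  by (rule fps_ext) simp

text \<open>The shift divides \<open>e^t - 1\<close> by \<open>t\<close>, which makes the constant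
  coefficient 1 and the series invertible.\<close>

lemma fps_bernoulli_mult: "fps_shift 1 (fps_exp 1 - 1) * fps_bernoulli = 1"
  unfolding fps_bernoulli_def by (rule inverse_mult_eq_1') simp

text \<open>Compare coefficients of \<open>t^n\<close> in the geometric sum of the
  \<open>e^(yt)\<close>. Pulling out \<open>M\<close> prepares the division by \<open>p ^ N\<close>:
  what remains is a polynomial in \<open>M\<close> with coefficients independent of
  \<open>M\<close>.\<close>

lemma sum_powers_bernoulli:
  fixes M n :: nat
  shows "(\<Sum>y<M. of_nat y ^ n :: 'a::field_char_0) =
    of_nat M * (\<Sum>j\<le>n. of_nat M ^ j * (fact n * fps_nth fps_bernoulli (n - j) / fact (Suc j)))"
proof -
  let ?E = "\<lambda>c::'a. fps_shift 1 (fps_exp c - 1)"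
  let ?S = "\<Sum>y<M. fps_exp (of_nat y) :: 'a fps"
  have "fps_X * ?E (of_nat M) = fps_exp 1 ^ M - 1"
    using fps_exp_minus_1_eq[of "of_nat M :: 'a"] by (simp add: fps_exp_power_mult)
  also have "\<dots> = (fps_exp 1 - 1) * ?S"
    by (subst power_diff_1_eq) (simp add: fps_exp_power_mult)
  also have "\<dots> = fps_X * (?E 1 * ?S)"
    by (subst fps_exp_minus_1_eq) (simp add: mult.assoc)
  finally have "?E (of_nat M) = ?E 1 * ?S"
    by simp
  then have "?E (of_nat M) * fps_bernoulli = (?E 1 * fps_bernoulli) * ?S"
    by (simp only: mult_ac)
  then have "?S = ?E (of_nat M) * fps_bernoulli"
    by (simp only: fps_bernoulli_mult mult_1)
  then have "fps_nth ?S n = fps_nth (?E (of_nat M) * fps_bernoulli) n"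
    by simp
  then have "(\<Sum>y<M. of_nat y ^ n :: 'a) / fact n =
      (\<Sum>j\<le>n. of_nat M ^ Suc j / fact (Suc j) * fps_nth fps_bernoulli (n - j))"
    by (simp add: fps_sum_nth fps_mult_nth atLeast0AtMost sum_divide_distrib del: fact_Suc)
  then have "(\<Sum>y<M. of_nat y ^ n :: 'a) =
      (\<Sum>j\<le>n. of_nat M ^ Suc j / fact (Suc j) * fps_nth fps_bernoulli (n - j)) * fact n"
    by (simp add: field_simps)
  then show ?thesis
    by (simp add: sum_distrib_left sum_distrib_right mult_ac del: fact_Suc)
qed

section \<open>Limits in the p-adic metric\<close>

context
  fixes p :: nat
  assumes p: "prime p" and Cp: "padic_complex_field p TYPE('a::{field_char_0, metric_space})"
begin

lemma padic_dist_translate: "dist (x + z) (y + z) = dist x (y::'a)"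
  using Cp by (simp add: padic_complex_field_def)

lemma padic_dist_mult: "dist (x * y) 0 = dist x 0 * dist (y::'a) 0"
  using Cp by (simp add: padic_complex_field_def)

text \<open>Field and metric are linked only through \<open>padic_complex_field\<close>, so
  continuity of addition comes from translation invariance, with the triangle inequality taken
  through \<open>a + g x\<close>.\<close>

lemma padic_tendsto_add:
  fixes a b :: 'a
  assumes "(f \<longlongrightarrow> a) F" "(g \<longlongrightarrow> b) F"
  shows "((\<lambda>x. f x + g x) \<longlongrightarrow> a + b) F"
proof -
  have "dist (f x + g x) (a + b) \<le> dist (f x) a + dist (g x) b" for x
    using dist_triangle[of "f x + g x" "a + b" "a + g x"]
      padic_dist_translate[of "f x" "g x" a] padic_dist_translate[of "g x" a b]
    by (simp add: add.commute)
  moreover have "((\<lambda>x. dist (f x) a + dist (g x) b) \<longlongrightarrow> 0) F"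
    using assms[THEN tendsto_dist_iff[THEN iffD1]] by (rule tendsto_add_zero)
  ultimately show ?thesis
    by (elim metric_tendsto_imp_tendsto) (simp add: dist_real_def)
qed

lemma padic_tendsto_mult_right:
  fixes a c :: 'a
  assumes "(f \<longlongrightarrow> a) F"
  shows "((\<lambda>x. f x * c) \<longlongrightarrow> a * c) F"
proof -
  have diff: "dist u v = dist (u - v) 0" for u v :: 'a
    using padic_dist_translate[of u "- v" v] by simp
  have "dist (f x * c) (a * c) = dist (f x) a * dist c 0" for x
    by (metis diff left_diff_distrib padic_dist_mult)
  moreover have "((\<lambda>x. dist (f x) a * dist c 0) \<longlongrightarrow> 0) F"
    using assms[THEN tendsto_dist_iff[THEN iffD1]] by (rule tendsto_mult_left_zero)
  ultimately show ?thesis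
    by (subst tendsto_dist_iff) simp
qed

lemma padic_tendsto_sum:
  fixes a :: "'i \<Rightarrow> 'a"
  assumes "\<And>i. i \<in> A \<Longrightarrow> (f i \<longlongrightarrow> a i) F"
  shows "((\<lambda>x. \<Sum>i\<in>A. f i x) \<longlongrightarrow> (\<Sum>i\<in>A. a i)) F"
  using assms by (induction A rule: infinite_finite_induct) (simp_all add: padic_tendsto_add)

lemma padic_dist_prime: "dist (of_nat p :: 'a) 0 = 1 / real p"
proof -
  have "dist (of_rat (of_nat p) :: 'a) 0 = padic_abs p (of_nat p)"
    using Cp unfolding padic_complex_field_def by blast
  moreover have "quotient_of (of_nat p) = (int p, 1)"
    using quotient_of_int[of "int p"] by (simp flip: Rat.of_int_def)
  moreover have "multiplicity (int p) (int p) = 1"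
    using p by (intro multiplicity_self) (auto simp: prime_gt_0_nat)
  ultimately show ?thesis
    using p by (simp add: padic_abs_def power_int_minus divide_inverse prime_gt_0_nat)
qed

lemma padic_prime_power_tendsto_0:
  assumes "j > 0"
  shows "(\<lambda>N. (of_nat p ^ N) ^ j :: 'a) \<longlonglongrightarrow> 0"
proof -
  \<comment> \<open>The value is a nonzero idempotent real.\<close>
  have one: "dist (1::'a) 0 = 1"
    using padic_dist_mult[of 1 1] by simp
  have pow: "dist (x ^ m) 0 = dist x 0 ^ m" for x :: 'a and m
    by (induction m) (simp_all add: one padic_dist_mult)
  have "(1 / real p) ^ j < 1"
    using assms prime_gt_1_nat[OF p] by (intro power_less_one_iff[THEN iffD2]) auto
  then have "(\<lambda>N. ((1 / real p) ^ j) ^ N) \<longlonglongrightarrow> 0"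
    by (intro LIMSEQ_power_zero) simp
  then show ?thesis
    by (subst tendsto_dist_iff) (simp add: pow padic_dist_prime mult.commute flip: power_mult)
qed

section \<open>Moments and integrals of polynomials\<close>

lemma padic_moment_tendsto:
  "(\<lambda>N. inverse (of_nat p ^ N) * (\<Sum>y<p ^ N. of_nat y ^ n)) \<longlonglongrightarrow>
     (fact n * fps_nth fps_bernoulli n :: 'a)"
proof -
  define c :: "nat \<Rightarrow> 'a" where "c j = fact n * fps_nth fps_bernoulli (n - j) / fact (Suc j)" for j
  have "p \<noteq> 0"
    using p by auto
  then have "inverse (of_nat p ^ N) * (\<Sum>y<p ^ N. of_nat y ^ n) = (\<Sum>j\<le>n. (of_nat p ^ N) ^ j * c j)" for N
    by (simp add: sum_powers_bernoulli c_def flip: mult.assoc)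
  \<comment> \<open>The power with \<open>j = 0\<close> is constantly 1; all others tend to
    0.\<close>
  moreover have "(\<lambda>N. \<Sum>j\<le>n. (of_nat p ^ N) ^ j * c j) \<longlonglongrightarrow> (\<Sum>j\<le>n. (if j = 0 then 1 else 0) * c j)"
    by (intro padic_tendsto_sum padic_tendsto_mult_right) (simp add: padic_prime_power_tendsto_0)
  moreover have "(\<Sum>j\<le>n. (if j = 0 then 1 else 0) * c j) = c 0"
    by (simp add: if_distrib[of "\<lambda>x. x * _"] cong: if_cong)
  moreover have "c 0 = fact n * fps_nth fps_bernoulli n"
    by (simp add: c_def)
  ultimately show ?thesis
    by simp
qed

lemma padic_integral_exp_eq: "padic_integral_exp p = (fps_bernoulli :: 'a fps)"
  by (rule fps_ext) (simp add: padic_integral_exp_def padic_integral_def limI[OF padic_moment_tendsto])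

text \<open>Taylor expansion in \<open>y\<close> reduces the integral to moments; the
  \<open>n!\<close> in each moment cancels the one in the Taylor coefficient.\<close>

lemma padic_integral_poly_shift:
  "padic_integral p (\<lambda>y. poly q (x + y)) = poly (umbral_op fps_bernoulli q) (x :: 'a)"
proof -
  define d where "d n = poly ((pderiv ^^ n) q) x / fact n" for n
  have "inverse (of_nat p ^ N) * (\<Sum>y<p ^ N. poly q (x + of_nat y)) =
      (\<Sum>n\<le>degree q. inverse (of_nat p ^ N) * (\<Sum>y<p ^ N. of_nat y ^ n) * d n)" for N
  proof -
    have "(\<Sum>y<p ^ N. poly q (x + of_nat y)) = (\<Sum>n\<le>degree q. \<Sum>y<p ^ N. d n * of_nat y ^ n)"
      unfolding poly_taylor d_def by (rule sum.swap)
    also have "\<dots> = (\<Sum>n\<le>degree q. (\<Sum>y<p ^ N. of_nat y ^ n) * d n)"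
      by (simp add: mult.commute flip: sum_distrib_left)
    finally show ?thesis
      by (simp add: mult.assoc flip: sum_distrib_left)
  qed
  moreover have "(\<lambda>N. \<Sum>n\<le>degree q. inverse (of_nat p ^ N) * (\<Sum>y<p ^ N. of_nat y ^ n) * d n)
      \<longlonglongrightarrow> (\<Sum>n\<le>degree q. fact n * fps_nth fps_bernoulli n * d n)"
    by (intro padic_tendsto_sum padic_tendsto_mult_right padic_moment_tendsto)
  moreover have "(\<Sum>n\<le>degree q. fact n * fps_nth fps_bernoulli n * d n) = poly (umbral_op fps_bernoulli q) x"
    by (simp add: umbral_op_def d_def poly_sum)
  ultimately show ?thesis
    unfolding padic_integral_def by (intro limI) simp
qed

text \<open>The description is unique because in characteristic 0 a polynomial is determined by its
  values.\<close>

lemma padic_integral_shift_eq: "padic_integral_shift p q = umbral_op fps_bernoulli (q :: 'a poly)"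
  unfolding padic_integral_shift_def padic_integral_poly_shift
  by (rule the_equality) (auto intro: poly_ext)

end

section \<open>The quotients defining F and G\<close>

lemma fps_one_plus_pow_nth_1: "fps_nth (fps_one_plus_pow lam a) 1 = a * lam"
  by (simp add: fps_one_plus_pow_def fps_compose_nth fps_ln_nth)

lemma F_series_mult_bernoulli:
  fixes lam :: "'a::field_char_0"
  assumes "lam \<noteq> 0"
  shows "F_series k lam * fps_bernoulli = G_series k lam"
proof -
  define L where "L = fps_polylog k oo (1 - fps_one_plus_pow lam (- 1 / lam))"
  define D where "D = fps_one_plus_pow lam (1 / lam) - 1"
  let ?E = "fps_shift 1 (fps_exp 1 - 1) :: 'a fps"
  \<comment> \<open>The linear coefficient is \<open>1 / lam * lam = 1\<close>, by
    \<open>lam \<noteq> 0\<close>.\<close>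
  have D1: "fps_nth D 1 \<noteq> 0"
    using assms by (simp only: D_def fps_sub_nth fps_one_plus_pow_nth_1) simp
  then have "D \<noteq> 0"
    by auto
  have L0: "fps_nth L 0 = 0"
    by (simp add: L_def fps_polylog_def)
  \<comment> \<open>Exactness of the division lets both quotients be cancelled like fractions. It
    holds because \<open>D\<close> has order at most 1 and \<open>L\<close> has no constant
    term.\<close>
  have "D dvd L"
  proof (cases "L = 0")
    case False
    have "subdegree D \<le> 1"
      using D1 by (rule subdegree_leI)
    also have "1 \<le> subdegree L"
      using False L0 by (intro subdegree_geI) auto
    finally show ?thesis
      using False \<open>D \<noteq> 0\<close> by (simp add: fps_dvd_iff)
  qed simp
  then obtain Q where Q: "L = D * Q" ..
  have "F_series k lam = (fps_exp 1 - 1) * L / (fps_X * D)"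
    by (simp add: F_series_def L_def D_def)
  \<comment> \<open>The factor \<open>t\<close> of the denominator is supplied by
    \<open>e^t - 1\<close>, the factor \<open>D\<close> by \<open>L\<close>.\<close>
  also have "(fps_exp 1 - 1) * L = (fps_X * D) * (?E * Q)"
    by (subst fps_exp_minus_1_eq) (simp add: Q mult_ac)
  also have "\<dots> / (fps_X * D) = ?E * Q"
    using \<open>D \<noteq> 0\<close> by (intro nonzero_mult_div_cancel_left) simp
  finally have "F_series k lam * fps_bernoulli = (?E * fps_bernoulli) * Q"
    by (simp add: mult_ac)
  also have "\<dots> = L / D"
    using \<open>D \<noteq> 0\<close> by (simp only: fps_bernoulli_mult Q) simp
  finally show ?thesis
    by (simp add: G_series_def L_def D_def)
qed

theorem theorem2:
  fixes p :: nat and k :: int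
    and lam :: "'a::{field_char_0, metric_space}" and q :: "'a poly"
  assumes "prime p"
    and "padic_complex_field p TYPE('a)"
    and "lam \<noteq> 0"
  shows "umbral_op (F_series k lam) (padic_integral_shift p q) =
           umbral_op (F_series k lam) (umbral_op (padic_integral_exp p) q) \<and>
         umbral_op (F_series k lam) (umbral_op (padic_integral_exp p) q) =
           umbral_op (G_series k lam) q"
  using assms
  by (simp add: padic_integral_shift_eq padic_integral_exp_eq umbral_op_mult F_series_mult_bernoulli)

end
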